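(* Let $\mathcal{C}$ be a path category and let $m: A \to C$, $f: A \to B$, $p: C \to D$, $n: B \to D$ be maps in $\mathcal{C}$ with $pm = nf$, where $f$ is a weak equivalence and $p$ is a fibration. Then there is a map $l: B \to C$ such that $pl = n$ and $lf \simeq_D m$. Moreover, such a map $l$ is unique up to fibrewise homotopy over $D$ (with respect to $p: C \to D$).
   Context: A path category is a category $\mathcal{C}$ with two classes of maps, fibrations and weak equivalences (maps in both classes are called acyclic fibrations), such that: (1) fibrations are closed under composition; (2) the pullback of a fibration along any map exists and is a fibration; (3) the pullback of an acyclic fibration along any map is an acyclic fibration; (4) 2-out-of-6: if $f:A\to B$, $g:B\to C$, $h:C\to D$ and $gf$, $hg$ are weak equivalences, then so are $f,g,h,hgf$; (5) isomorphisms are acyclic fibrations and every acyclic fibration has a section; (6) every object $B$ has a path object, i.e. a factorisation of the diagonal $B \to B\times B$ as a weak equivalence $r: B \to PB$ followed by a fibration $(s,t): PB \to B \times B$; (7) there is a terminal object $1$ and every map $X \to 1$ is a fibration. For an object $A$, $\mathcal{C}(A)$ is the full subcategory of $\mathcal{C}/A$ on the fibrations with codomain $A$, with fibrations and weak equivalences as in $\mathcal{C}$; it is again a path category. If $p: X \to I$ is a fibration and $f, g: Y \to X$ satisfy $pf = pg$, then $f$ and $g$ are fibrewise homotopic over $I$, written $f \simeq_I g$, if for a path object $(s,t): P_I(X) \to X \times_I X$ of $X$ in $\mathcal{C}(I)$ there is $h: Y \to P_I(X)$ with $sh = f$ and $th = g$ (here $pf=pg$ need not be a fibration). *)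

theory Defs
  imports Main
begin

record ('o, 'm) cat_data =
  Ob :: "'o set"
  Arr :: "'m set"
  Dom :: "'m \<Rightarrow> 'o"
  Cod :: "'m \<Rightarrow> 'o"
  Id :: "'o \<Rightarrow> 'm"
  Comp :: "'m \<Rightarrow> 'm \<Rightarrow> 'm"  (infixr "\<cdot>\<index>" 70)

definition Hom :: "('o, 'm, 'z) cat_data_scheme \<Rightarrow> 'o \<Rightarrow> 'o \<Rightarrow> 'm set" where
  "Hom C X Y = {f \<in> Arr C. Dom C f = X \<and> Cod C f = Y}"

locale category =
  fixes C :: "('o, 'm, 'z) cat_data_scheme" (structure)
  assumes Dom_in_Ob: "f \<in> Arr C \<Longrightarrow> Dom C f \<in> Ob C"
    and Cod_in_Ob: "f \<in> Arr C \<Longrightarrow> Cod C f \<in> Ob C"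
    and Id_in_Hom: "X \<in> Ob C \<Longrightarrow> Id C X \<in> Hom C X X"
    and Comp_in_Hom: "\<lbrakk>f \<in> Hom C X Y; g \<in> Hom C Y Z\<rbrakk> \<Longrightarrow> g \<cdot> f \<in> Hom C X Z"
    and Id_left: "f \<in> Hom C X Y \<Longrightarrow> Id C Y \<cdot> f = f"
    and Id_right: "f \<in> Hom C X Y \<Longrightarrow> f \<cdot> Id C X = f"
    and Comp_assoc: "\<lbrakk>f \<in> Hom C W X; g \<in> Hom C X Y; h \<in> Hom C Y Z\<rbrakk>
      \<Longrightarrow> (h \<cdot> g) \<cdot> f = h \<cdot> (g \<cdot> f)"

definition is_iso :: "('o, 'm, 'z) cat_data_scheme \<Rightarrow> 'm \<Rightarrow> bool" where
  "is_iso C f \<longleftrightarrow> f \<in> Arr C \<and> (\<exists>g \<in> Hom C (Cod C f) (Dom C f).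
     g \<cdot>\<^bsub>C\<^esub> f = Id C (Dom C f) \<and> f \<cdot>\<^bsub>C\<^esub> g = Id C (Cod C f))"

definition is_terminal :: "('o, 'm, 'z) cat_data_scheme \<Rightarrow> 'o \<Rightarrow> bool" where
  "is_terminal C T \<longleftrightarrow> T \<in> Ob C \<and> (\<forall>X \<in> Ob C. \<exists>!f. f \<in> Hom C X T)"

definition is_product ::
  "('o, 'm, 'z) cat_data_scheme \<Rightarrow> 'o \<Rightarrow> 'o \<Rightarrow> 'o \<Rightarrow> 'm \<Rightarrow> 'm \<Rightarrow> bool" where
  "is_product C X Y Q \<pi>1 \<pi>2 \<longleftrightarrow> \<pi>1 \<in> Hom C Q X \<and> \<pi>2 \<in> Hom C Q Y \<and>
     (\<forall>W. \<forall>u \<in> Hom C W X. \<forall>v \<in> Hom C W Y.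
        \<exists>!e. e \<in> Hom C W Q \<and> \<pi>1 \<cdot>\<^bsub>C\<^esub> e = u \<and> \<pi>2 \<cdot>\<^bsub>C\<^esub> e = v)"

text \<open>\<^term>\<open>is_pullback C p f q g\<close>: the square
  \<^term>\<open>p \<cdot>\<^bsub>C\<^esub> g = f \<cdot>\<^bsub>C\<^esub> q\<close> is a pullback, exhibiting \<^term>\<open>q\<close> as the
  pullback of \<^term>\<open>p\<close> along \<^term>\<open>f\<close>.\<close>

definition is_pullback ::
  "('o, 'm, 'z) cat_data_scheme \<Rightarrow> 'm \<Rightarrow> 'm \<Rightarrow> 'm \<Rightarrow> 'm \<Rightarrow> bool" where
  "is_pullback C p f q g \<longleftrightarrow>
     p \<in> Arr C \<and> f \<in> Arr C \<and> Cod C p = Cod C f \<and>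
     q \<in> Hom C (Dom C q) (Dom C f) \<and> g \<in> Hom C (Dom C q) (Dom C p) \<and>
     p \<cdot>\<^bsub>C\<^esub> g = f \<cdot>\<^bsub>C\<^esub> q \<and>
     (\<forall>W. \<forall>u \<in> Hom C W (Dom C f). \<forall>v \<in> Hom C W (Dom C p). p \<cdot>\<^bsub>C\<^esub> v = f \<cdot>\<^bsub>C\<^esub> u \<longrightarrow>
        (\<exists>!e. e \<in> Hom C W (Dom C q) \<and> q \<cdot>\<^bsub>C\<^esub> e = u \<and> g \<cdot>\<^bsub>C\<^esub> e = v))"

record ('o, 'm) path_cat_data = "('o, 'm) cat_data" +
  Fib :: "'m set"
  Weq :: "'m set"

text \<open>\<^term>\<open>is_path_object C B P r s t\<close>: the diagonal \<open>d\<close> of \<^term>\<open>B\<close> factors as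
  the weak equivalence \<^term>\<open>r\<close> followed by a fibration \<open>e = (s, t)\<close>.  The product is only
  determined up to isomorphism, so it is quantified existentially; in a path category the choice
  is immaterial, isomorphisms being fibrations.\<close>

definition is_path_object ::
  "('o, 'm, 'z) path_cat_data_scheme \<Rightarrow> 'o \<Rightarrow> 'o \<Rightarrow> 'm \<Rightarrow> 'm \<Rightarrow> 'm \<Rightarrow> bool" where
  "is_path_object C B P r s t \<longleftrightarrow>
     r \<in> Hom C B P \<and> r \<in> Weq C \<and>
     (\<exists>Q \<pi>1 \<pi>2 d e. is_product C B B Q \<pi>1 \<pi>2 \<and>
        d \<in> Hom C B Q \<and> \<pi>1 \<cdot>\<^bsub>C\<^esub> d = Id C B \<and> \<pi>2 \<cdot>\<^bsub>C\<^esub> d = Id C B \<and>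
        e \<in> Hom C P Q \<and> e \<in> Fib C \<and> \<pi>1 \<cdot>\<^bsub>C\<^esub> e = s \<and> \<pi>2 \<cdot>\<^bsub>C\<^esub> e = t \<and>
        e \<cdot>\<^bsub>C\<^esub> r = d)"

locale path_category = category C
  for C :: "('o, 'm, 'z) path_cat_data_scheme" (structure) +
  assumes Fib_subset: "Fib C \<subseteq> Arr C"
    and Weq_subset: "Weq C \<subseteq> Arr C"
    and Fib_Comp: "\<lbrakk>f \<in> Hom C X Y; g \<in> Hom C Y Z; f \<in> Fib C; g \<in> Fib C\<rbrakk>
      \<Longrightarrow> g \<cdot> f \<in> Fib C"
    and Fib_pullback_exists: "\<lbrakk>p \<in> Fib C; f \<in> Arr C; Cod C f = Cod C p\<rbrakk>
      \<Longrightarrow> \<exists>q g. is_pullback C p f q g"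
    and Fib_pullback: "\<lbrakk>p \<in> Fib C; is_pullback C p f q g\<rbrakk> \<Longrightarrow> q \<in> Fib C"
    and acyclic_Fib_pullback: "\<lbrakk>p \<in> Fib C \<inter> Weq C; is_pullback C p f q g\<rbrakk>
      \<Longrightarrow> q \<in> Fib C \<inter> Weq C"
    and two_out_of_six: "\<lbrakk>f \<in> Hom C X Y; g \<in> Hom C Y Z; h \<in> Hom C Z W;
        g \<cdot> f \<in> Weq C; h \<cdot> g \<in> Weq C\<rbrakk>
      \<Longrightarrow> f \<in> Weq C \<and> g \<in> Weq C \<and> h \<in> Weq C \<and> h \<cdot> (g \<cdot> f) \<in> Weq C"
    and iso_acyclic_Fib: "is_iso C f \<Longrightarrow> f \<in> Fib C \<inter> Weq C"
    and acyclic_Fib_section: "p \<in> Fib C \<inter> Weq C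
      \<Longrightarrow> \<exists>s \<in> Hom C (Cod C p) (Dom C p). p \<cdot> s = Id C (Cod C p)"
    and path_object_exists: "B \<in> Ob C \<Longrightarrow> \<exists>P r s t. is_path_object C B P r s t"
    and terminal_exists: "\<exists>T. is_terminal C T \<and> (\<forall>X. Hom C X T \<subseteq> Fib C)"

text \<open>The category \<open>C(A)\<close> of fibrations over \<^term>\<open>A\<close>: its objects are the fibrations
  themselves, and a map from \<open>p\<close> to \<open>q\<close> over \<^term>\<open>A\<close> is encoded as a triple
  \<open>(p, f, q)\<close>, because \<open>f\<close> alone does not determine \<open>q\<close>.\<close>

definition fib_over ::
  "('o, 'm, 'z) path_cat_data_scheme \<Rightarrow> 'o \<Rightarrow> ('m, 'm \<times> 'm \<times> 'm) path_cat_data" where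
  "fib_over C A =
    (let obs = {p \<in> Fib C. Cod C p = A};
         arrs = {(p, f, q). p \<in> obs \<and> q \<in> obs \<and>
                   f \<in> Hom C (Dom C p) (Dom C q) \<and> q \<cdot>\<^bsub>C\<^esub> f = p}
     in \<lparr> Ob = obs,
          Arr = arrs,
          Dom = (\<lambda>(p, f, q). p),
          Cod = (\<lambda>(p, f, q). q),
          Id = (\<lambda>p. (p, Id C (Dom C p), p)),
          Comp = (\<lambda>(q', g, r) (p, f, q). (p, g \<cdot>\<^bsub>C\<^esub> f, r)),
          Fib = {(p, f, q) \<in> arrs. f \<in> Fib C},
          Weq = {(p, f, q) \<in> arrs. f \<in> Weq C} \<rparr>)"

definition underlying :: "'m \<times> 'm \<times> 'm \<Rightarrow> 'm" where
  "underlying = (\<lambda>(p, f, q). f)"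

text \<open>Fibrewise homotopy over \<^term>\<open>Cod C p\<close>, with respect to the fibration \<^term>\<open>p\<close>.  The path
  object \<open>PX\<close> (an object of \<open>C(Cod p)\<close>, hence itself a fibration) lives in the slice,
  but the homotopy \<open>h\<close> is a map of \<^term>\<open>C\<close>, since the common composite of \<^term>\<open>f\<close> and
  \<^term>\<open>g\<close> with \<^term>\<open>p\<close> need not be a fibration.\<close>

definition fib_homotopic ::
  "('o, 'm, 'z) path_cat_data_scheme \<Rightarrow> 'm \<Rightarrow> 'm \<Rightarrow> 'm \<Rightarrow> bool" where
  "fib_homotopic C p f g \<longleftrightarrow>
     p \<in> Fib C \<and> f \<in> Hom C (Dom C f) (Dom C p) \<and> g \<in> Hom C (Dom C f) (Dom C p) \<and>
     p \<cdot>\<^bsub>C\<^esub> f = p \<cdot>\<^bsub>C\<^esub> g \<and>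
     (\<exists>PX r s t h. is_path_object (fib_over C (Cod C p)) p PX r s t \<and>
        h \<in> Hom C (Dom C f) (Dom C PX) \<and>
        underlying s \<cdot>\<^bsub>C\<^esub> h = f \<and> underlying t \<cdot>\<^bsub>C\<^esub> h = g)"

end

theory Submission
  imports Defs
begin

text \<open>
  Pulling \<open>p\<close> back along \<open>n\<close> and factoring the induced map out of \<open>A\<close> as a weak equivalence
  \<open>w : A \<rightarrow> E\<close> followed by a fibration yields an acyclic fibration \<open>k : E \<rightarrow> B\<close> and a map
  \<open>v : E \<rightarrow> C\<close> with \<open>kw = f\<close>, \<open>vw = m\<close> and \<open>pv = nk\<close>; a section \<open>a\<close> of \<open>k\<close> gives the
  lift \<open>l = va\<close>, for which the lower triangle commutes strictly.  Everything about homotopies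
  follows by applying this strict half again, to fibrations \<open>P \<rightarrow> C \<times>\<^sub>D C\<close> given by path
  objects: lifting along the diagonal of \<open>E\<close> over \<open>B\<close> (a weak equivalence) gives
  \<open>vaf \<simeq> vw\<close>, lifting along \<open>r\<close> compares path objects, lifting along the diagonal map
  \<open>C \<rightarrow> P \<times>\<^sub>C P\<close> composes homotopies, and lifting along \<open>f\<close> extends a homotopy from \<open>lf\<close> to
  \<open>l'f\<close> to one from \<open>l\<close> to \<open>l'\<close>.
\<close>

section \<open>Composition, pullbacks and products in a category\<close>

lemma (in category) Hom_iff:
  "f \<in> Hom C X Y \<longleftrightarrow> f \<in> Arr C \<and> Dom C f = X \<and> Cod C f = Y"
  by (auto simp: Hom_def)

lemma (in category) Id_typing:
  assumes "X \<in> Ob C"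
  shows "Id C X \<in> Arr C" "Dom C (Id C X) = X" "Cod C (Id C X) = X"
  using Id_in_Hom[OF assms] by (auto simp: Hom_iff)

lemma (in category) Hom_Ob:
  assumes "f \<in> Hom C X Y"
  shows "X \<in> Ob C" "Y \<in> Ob C"
  using assms Dom_in_Ob[of f] Cod_in_Ob[of f] by (auto simp: Hom_iff)

text \<open>This and the next two lemmas package associativity for precomposing a known square or
  triangle with a further map \<open>x\<close>, so that diagram chases need no rewriting modulo
  associativity.\<close>

lemma (in category) Comp_eq_Comp:
  assumes "g \<cdot> f = g' \<cdot> f'" "x \<in> Hom C W X"
    "f \<in> Hom C X Y" "g \<in> Hom C Y Z" "f' \<in> Hom C X Y'" "g' \<in> Hom C Y' Z"
  shows "g \<cdot> (f \<cdot> x) = g' \<cdot> (f' \<cdot> x)"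
  using assms(1) Comp_assoc[OF assms(2,3,4)] Comp_assoc[OF assms(2,5,6)] by simp

lemma (in category) Comp_eq_Arr:
  assumes "g \<cdot> f = k" "x \<in> Hom C W X" "f \<in> Hom C X Y" "g \<in> Hom C Y Z"
  shows "g \<cdot> (f \<cdot> x) = k \<cdot> x"
  using assms(1) Comp_assoc[OF assms(2,3,4)] by simp

lemma (in category) Comp_eq_Id:
  assumes "g \<cdot> f = Id C X" "x \<in> Hom C W X" "f \<in> Hom C X Y" "g \<in> Hom C Y X"
  shows "g \<cdot> (f \<cdot> x) = x"
  using Comp_eq_Arr[OF assms] Id_left[OF assms(2)] by simp

lemma (in category) is_pullbackI:
  assumes "p \<in> Hom C Y Z" "f \<in> Hom C X Z" "q \<in> Hom C E X" "g \<in> Hom C E Y" "p \<cdot> g = f \<cdot> q"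
    and "\<And>W u v. \<lbrakk>u \<in> Hom C W X; v \<in> Hom C W Y; p \<cdot> v = f \<cdot> u\<rbrakk>
      \<Longrightarrow> \<exists>e \<in> Hom C W E. q \<cdot> e = u \<and> g \<cdot> e = v"
    and "\<And>W e e'. \<lbrakk>e \<in> Hom C W E; e' \<in> Hom C W E; q \<cdot> e = q \<cdot> e'; g \<cdot> e = g \<cdot> e'\<rbrakk> \<Longrightarrow> e = e'"
  shows "is_pullback C p f q g"
proof -
  have dc: "Dom C p = Y" "Dom C f = X" "Dom C q = E" "Cod C p = Cod C f" "p \<in> Arr C" "f \<in> Arr C"
    using assms(1-3) by (auto simp: Hom_iff)
  show ?thesis
    unfolding is_pullback_def dc
  proof (intro conjI allI ballI impI)
    fix W u v
    assume "u \<in> Hom C W X" "v \<in> Hom C W Y" "p \<cdot> v = f \<cdot> u"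
    then obtain e where e: "e \<in> Hom C W E" "q \<cdot> e = u" "g \<cdot> e = v"
      using assms(6) by blast
    show "\<exists>!e. e \<in> Hom C W E \<and> q \<cdot> e = u \<and> g \<cdot> e = v"
    proof (rule ex1I[of _ e])
      show "e' = e" if "e' \<in> Hom C W E \<and> q \<cdot> e' = u \<and> g \<cdot> e' = v" for e'
        using that e by (intro assms(7)[of e' W e]) simp_all
    qed (simp add: e)
  qed (simp_all add: assms(3-5) dc(5,6))
qed

lemma (in category) is_pullbackD:
  assumes "is_pullback C p f q g" "q \<in> Hom C E X" "g \<in> Hom C E Y"
  shows "Dom C f = X" "Dom C p = Y" "Dom C q = E" "p \<cdot> g = f \<cdot> q"
    "p \<in> Hom C Y (Cod C p)" "f \<in> Hom C X (Cod C p)"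
proof -
  have "p \<in> Arr C" "f \<in> Arr C" "Cod C p = Cod C f" "q \<in> Hom C (Dom C q) (Dom C f)"
    "g \<in> Hom C (Dom C q) (Dom C p)" "p \<cdot> g = f \<cdot> q"
    using assms(1) unfolding is_pullback_def by blast+
  then show "Dom C f = X" "Dom C p = Y" "Dom C q = E" "p \<cdot> g = f \<cdot> q"
    "p \<in> Hom C Y (Cod C p)" "f \<in> Hom C X (Cod C p)"
    using assms(2,3) by (simp_all add: Hom_iff)
qed

lemma (in category) pullback_lift:
  assumes "is_pullback C p f q g" "q \<in> Hom C E X" "g \<in> Hom C E Y"
    and "u \<in> Hom C W X" "v \<in> Hom C W Y" "p \<cdot> v = f \<cdot> u"
  obtains e where "e \<in> Hom C W E" "q \<cdot> e = u" "g \<cdot> e = v"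
proof -
  have "\<exists>!e. e \<in> Hom C W E \<and> q \<cdot> e = u \<and> g \<cdot> e = v"
    using assms(1,4-6) unfolding is_pullback_def is_pullbackD(1-3)[OF assms(1-3)] by blast
  then show thesis
    using that by blast
qed

lemma (in category) pullback_eqI:
  assumes "is_pullback C p f q g" "q \<in> Hom C E X" "g \<in> Hom C E Y"
    and e: "e \<in> Hom C W E" "e' \<in> Hom C W E" and eq: "q \<cdot> e = q \<cdot> e'" "g \<cdot> e = g \<cdot> e'"
  shows "e = e'"
proof -
  note dc = is_pullbackD[OF assms(1-3)]
  have "p \<cdot> (g \<cdot> e) = f \<cdot> (q \<cdot> e)"
    using Comp_eq_Comp[OF dc(4) e(1) assms(3) dc(5) assms(2) dc(6)] .
  moreover have "q \<cdot> e \<in> Hom C W X" "g \<cdot> e \<in> Hom C W Y"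
    using Comp_in_Hom e(1) assms(2,3) by blast+
  ultimately have "\<exists>!x. x \<in> Hom C W E \<and> q \<cdot> x = q \<cdot> e \<and> g \<cdot> x = g \<cdot> e"
    using assms(1) unfolding is_pullback_def dc(1-3) by blast
  moreover have "e \<in> Hom C W E \<and> q \<cdot> e = q \<cdot> e \<and> g \<cdot> e = g \<cdot> e"
    "e' \<in> Hom C W E \<and> q \<cdot> e' = q \<cdot> e \<and> g \<cdot> e' = g \<cdot> e"
    using e eq by simp_all
  ultimately show ?thesis
    by blast
qed

lemma (in category) is_pullback_swap:
  assumes "is_pullback C p f q g" "q \<in> Hom C E X" "g \<in> Hom C E Y"
  shows "is_pullback C f p g q"
proof (rule is_pullbackI)
  show "f \<in> Hom C X (Cod C p)" "p \<in> Hom C Y (Cod C p)" "f \<cdot> q = p \<cdot> g"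
    using is_pullbackD[OF assms] by simp_all
next
  fix W u v
  assume "u \<in> Hom C W Y" "v \<in> Hom C W X" "f \<cdot> v = p \<cdot> u"
  then show "\<exists>e \<in> Hom C W E. g \<cdot> e = u \<and> q \<cdot> e = v"
    using pullback_lift[OF assms, of v W u] by metis
next
  fix W e e'
  assume "e \<in> Hom C W E" "e' \<in> Hom C W E" "g \<cdot> e = g \<cdot> e'" "q \<cdot> e = q \<cdot> e'"
  then show "e = e'"
    using pullback_eqI[OF assms, of e W e'] by simp
qed (fact assms)+

lemma (in category) product_lift:
  assumes "is_product C X Y Q \<pi>1 \<pi>2" "u \<in> Hom C W X" "v \<in> Hom C W Y"
  obtains e where "e \<in> Hom C W Q" "\<pi>1 \<cdot> e = u" "\<pi>2 \<cdot> e = v"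
proof -
  have "\<exists>!e. e \<in> Hom C W Q \<and> \<pi>1 \<cdot> e = u \<and> \<pi>2 \<cdot> e = v"
    using assms unfolding is_product_def by simp
  then show thesis
    using that by blast
qed

lemma (in category) product_eqI:
  assumes "is_product C X Y Q \<pi>1 \<pi>2" "e \<in> Hom C W Q" "e' \<in> Hom C W Q"
    "\<pi>1 \<cdot> e = \<pi>1 \<cdot> e'" "\<pi>2 \<cdot> e = \<pi>2 \<cdot> e'"
  shows "e = e'"
proof -
  have "\<pi>1 \<cdot> e \<in> Hom C W X" "\<pi>2 \<cdot> e \<in> Hom C W Y"
    using assms(1,2) Comp_in_Hom unfolding is_product_def by blast+
  then have "\<exists>!x. x \<in> Hom C W Q \<and> \<pi>1 \<cdot> x = \<pi>1 \<cdot> e \<and> \<pi>2 \<cdot> x = \<pi>2 \<cdot> e"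
    using assms(1) unfolding is_product_def by blast
  moreover have "e \<in> Hom C W Q \<and> \<pi>1 \<cdot> e = \<pi>1 \<cdot> e \<and> \<pi>2 \<cdot> e = \<pi>2 \<cdot> e"
    "e' \<in> Hom C W Q \<and> \<pi>1 \<cdot> e' = \<pi>1 \<cdot> e \<and> \<pi>2 \<cdot> e' = \<pi>2 \<cdot> e"
    using assms(2-5) by simp_all
  ultimately show ?thesis
    by blast
qed

section \<open>Weak equivalences, fibrations and factorizations\<close>

lemma (in path_category) Id_acyclic:
  assumes "X \<in> Ob C"
  shows "Id C X \<in> Fib C" "Id C X \<in> Weq C"
proof -
  have "is_iso C (Id C X)"
    using Id_in_Hom[OF assms] Id_left[OF Id_in_Hom[OF assms]] Id_typing[OF assms]
    unfolding is_iso_def by auto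
  then show "Id C X \<in> Fib C" "Id C X \<in> Weq C"
    using iso_acyclic_Fib by auto
qed

text \<open>All three cases of 2-out-of-3 follow from 2-out-of-6 by inserting an identity: between
  the two maps for composition, after \<open>g\<close> for \<open>Weq_cancel_left\<close>, before
  \<open>f\<close> for \<open>Weq_cancel_right\<close>.\<close>

lemma (in path_category) Weq_Comp:
  assumes "f \<in> Hom C X Y" "g \<in> Hom C Y Z" "f \<in> Weq C" "g \<in> Weq C"
  shows "g \<cdot> f \<in> Weq C"
  using two_out_of_six[OF assms(1) Id_in_Hom[OF Hom_Ob(1)[OF assms(2)]] assms(2)]
    Id_left[OF assms(1)] Id_right[OF assms(2)] assms(3,4) by simp

lemma (in path_category) Weq_cancel_left:
  assumes "f \<in> Hom C X Y" "g \<in> Hom C Y Z" "g \<cdot> f \<in> Weq C" "g \<in> Weq C"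
  shows "f \<in> Weq C"
  using two_out_of_six[OF assms(1,2) Id_in_Hom[OF Hom_Ob(2)[OF assms(2)]] assms(3)]
    Id_left[OF assms(2)] assms(4) by simp

lemma (in path_category) Weq_cancel_right:
  assumes "f \<in> Hom C X Y" "g \<in> Hom C Y Z" "g \<cdot> f \<in> Weq C" "f \<in> Weq C"
  shows "g \<in> Weq C"
  using two_out_of_six[OF Id_in_Hom[OF Hom_Ob(1)[OF assms(1)]] assms(1,2)]
    Id_right[OF assms(1)] assms(3,4) by simp

lemma (in path_category) pullback_of_Fib:
  assumes "p \<in> Hom C Y Z" "f \<in> Hom C X Z" "p \<in> Fib C"
  obtains E q g where "is_pullback C p f q g" "q \<in> Hom C E X" "g \<in> Hom C E Y"
    "p \<cdot> g = f \<cdot> q" "q \<in> Fib C" "p \<in> Weq C \<Longrightarrow> q \<in> Weq C"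
proof -
  obtain q g where pb: "is_pullback C p f q g"
    using Fib_pullback_exists[OF assms(3), of f] assms(1,2) by (auto simp: Hom_iff)
  show thesis
  proof (rule that[OF pb])
    have "Dom C f = X" "Dom C p = Y"
      using assms(1,2) by (auto simp: Hom_iff)
    then show "q \<in> Hom C (Dom C q) X" "g \<in> Hom C (Dom C q) Y" "p \<cdot> g = f \<cdot> q"
      using pb unfolding is_pullback_def by simp_all
    show "q \<in> Fib C"
      using Fib_pullback[OF assms(3) pb] .
    show "p \<in> Weq C \<Longrightarrow> q \<in> Weq C"
      using acyclic_Fib_pullback[OF _ pb] assms(3) by blast
  qed
qed

lemma (in path_category) to_terminal:
  obtains T where "\<forall>X \<in> Ob C. \<exists>!t. t \<in> Hom C X T" "\<forall>X. Hom C X T \<subseteq> Fib C"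
  using terminal_exists unfolding is_terminal_def by metis

text \<open>Maps to the terminal object are fibrations, so they can be pulled back along each other;
  every pair of maps into \<open>X\<close> and \<open>Y\<close> forms a cone over them.\<close>

lemma (in path_category) product_exists:
  assumes "X \<in> Ob C" "Y \<in> Ob C"
  obtains Q \<pi>1 \<pi>2 where "is_product C X Y Q \<pi>1 \<pi>2"
proof -
  obtain T where T: "\<forall>X \<in> Ob C. \<exists>!t. t \<in> Hom C X T" "\<forall>X. Hom C X T \<subseteq> Fib C"
    using to_terminal .
  note T = T(1)[rule_format] subsetD[OF T(2)[rule_format]]
  obtain x y where xy: "x \<in> Hom C X T" "y \<in> Hom C Y T"
    using T(1) assms by blast
  obtain E q g where E: "is_pullback C y x q g" "q \<in> Hom C E X" "g \<in> Hom C E Y"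
    using pullback_of_Fib[OF xy(2,1) T(2)[OF xy(2)]] by metis
  have "is_product C X Y E q g"
    unfolding is_product_def
  proof (intro conjI allI ballI)
    fix W u v
    assume uv: "u \<in> Hom C W X" "v \<in> Hom C W Y"
    have "y \<cdot> v = x \<cdot> u"
      using T(1)[OF Hom_Ob(1)[OF uv(1)]] Comp_in_Hom uv xy by blast
    from pullback_lift[OF E uv this]
    obtain e where e: "e \<in> Hom C W E" "q \<cdot> e = u" "g \<cdot> e = v" .
    show "\<exists>!e. e \<in> Hom C W E \<and> q \<cdot> e = u \<and> g \<cdot> e = v"
    proof (rule ex1I[of _ e])
      show "e' = e" if "e' \<in> Hom C W E \<and> q \<cdot> e' = u \<and> g \<cdot> e' = v" for e'
        using that e by (intro pullback_eqI[OF E, of e' W e]) simp_all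
    qed (simp add: e)
  qed (fact E)+
  then show thesis
    using that by blast
qed

text \<open>Any product, not only the one built above, is a pullback over the terminal object. This
  generality matters because path objects come with an unspecified product.\<close>

lemma (in path_category) product_proj_Fib:
  assumes "is_product C X Y Q \<pi>1 \<pi>2"
  shows "\<pi>1 \<in> Fib C" "\<pi>2 \<in> Fib C"
proof -
  obtain T where T: "\<forall>X \<in> Ob C. \<exists>!t. t \<in> Hom C X T" "\<forall>X. Hom C X T \<subseteq> Fib C"
    using to_terminal .
  note T = T(1)[rule_format] subsetD[OF T(2)[rule_format]]
  have pi: "\<pi>1 \<in> Hom C Q X" "\<pi>2 \<in> Hom C Q Y"
    using assms unfolding is_product_def by auto
  obtain x y where xy: "x \<in> Hom C X T" "y \<in> Hom C Y T"
    using T(1) Hom_Ob(2)[OF pi(1)] Hom_Ob(2)[OF pi(2)] by blast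
  have pb: "is_pullback C y x \<pi>1 \<pi>2"
  proof (rule is_pullbackI[OF xy(2,1) pi])
    show "y \<cdot> \<pi>2 = x \<cdot> \<pi>1"
      using T(1)[OF Hom_Ob(1)[OF pi(1)]] Comp_in_Hom pi xy by blast
  next
    fix W u v
    assume "u \<in> Hom C W X" "v \<in> Hom C W Y"
    then show "\<exists>e \<in> Hom C W Q. \<pi>1 \<cdot> e = u \<and> \<pi>2 \<cdot> e = v"
      using product_lift[OF assms] by metis
  qed (rule product_eqI[OF assms])
  show "\<pi>1 \<in> Fib C"
    using Fib_pullback[OF T(2)[OF xy(2)] pb] .
  show "\<pi>2 \<in> Fib C"
    using Fib_pullback[OF T(2)[OF xy(1)] is_pullback_swap[OF pb pi]] .
qed

text \<open>The mapping path space \<open>E = Y \<times>\<^sub>X PX\<close> is formed as the pullback of \<open>e = (s, t)\<close> along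
  \<open>u \<times> 1\<close>, which makes \<open>E \<rightarrow> Y \<times> X\<close> a fibration; that it is also the pullback of \<open>s\<close> along
  \<open>u\<close> makes \<open>E \<rightarrow> Y\<close> acyclic.\<close>

lemma (in path_category) factorization:
  assumes u: "u \<in> Hom C Y X"
  obtains E w \<pi> where "w \<in> Hom C Y E" "w \<in> Weq C" "\<pi> \<in> Hom C E X" "\<pi> \<in> Fib C" "\<pi> \<cdot> w = u"
proof -
  have ob: "Y \<in> Ob C" "X \<in> Ob C"
    using Hom_Ob[OF u] by auto
  obtain P r s t where "is_path_object C X P r s t"
    using path_object_exists[OF ob(2)] by blast
  then obtain Q \<pi>1 \<pi>2 d e where r: "r \<in> Hom C X P" "r \<in> Weq C"
    and Q: "is_product C X X Q \<pi>1 \<pi>2"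
    and d: "d \<in> Hom C X Q" "\<pi>1 \<cdot> d = Id C X" "\<pi>2 \<cdot> d = Id C X"
    and e: "e \<in> Hom C P Q" "e \<in> Fib C" "e \<cdot> r = d"
    unfolding is_path_object_def by blast
  have pi: "\<pi>1 \<in> Hom C Q X" "\<pi>2 \<in> Hom C Q X"
    using Q unfolding is_product_def by auto
  define s t where "s = \<pi>1 \<cdot> e" and "t = \<pi>2 \<cdot> e"
  have st: "s \<in> Hom C P X" "t \<in> Hom C P X" "s \<in> Fib C"
    using Comp_in_Hom[OF e(1)] Fib_Comp[OF e(1) _ e(2)] pi product_proj_Fib[OF Q]
    by (auto simp: s_def t_def)
  have sr: "s \<cdot> r = Id C X" "t \<cdot> r = Id C X"
    unfolding s_def t_def using Comp_assoc[OF r(1) e(1)] pi e(3) d(2,3) by auto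
  have s_Weq: "s \<in> Weq C"
    using Weq_cancel_right[OF r(1) st(1)] sr(1) Id_acyclic[OF ob(2)] r(2) by simp
  obtain R \<rho>1 \<rho>2 where R: "is_product C Y X R \<rho>1 \<rho>2"
    using product_exists[OF ob] .
  have rho: "\<rho>1 \<in> Hom C R Y" "\<rho>2 \<in> Hom C R X"
    using R unfolding is_product_def by auto
  \<comment> \<open>\<open>v\<close> is the map \<open>u \<times> 1\<close> from
    \<open>Y \<times> X\<close> to \<open>X \<times> X\<close>.\<close>
  obtain v where v: "v \<in> Hom C R Q" "\<pi>1 \<cdot> v = u \<cdot> \<rho>1" "\<pi>2 \<cdot> v = \<rho>2"
    using product_lift[OF Q Comp_in_Hom[OF rho(1) u] rho(2)] .
  obtain E e' g where pb: "is_pullback C e v e' g" "e' \<in> Hom C E R" "g \<in> Hom C E P"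
    and E: "e \<cdot> g = v \<cdot> e'" "e' \<in> Fib C"
    using pullback_of_Fib[OF e(1) v(1) e(2)] by metis
  define k where "k = \<rho>1 \<cdot> e'"
  define \<pi> where "\<pi> = \<rho>2 \<cdot> e'"
  have k: "k \<in> Hom C E Y" and \<pi>: "\<pi> \<in> Hom C E X" "\<pi> \<in> Fib C"
    using Comp_in_Hom[OF pb(2)] Fib_Comp[OF pb(2) _ E(2)] rho product_proj_Fib[OF R]
    by (auto simp: k_def \<pi>_def)
  have sg: "s \<cdot> g = u \<cdot> k"
    using Comp_assoc[OF pb(3) e(1) pi(1)] Comp_eq_Comp[OF v(2) pb(2) v(1) pi(1) rho(1) u] E(1)
    by (simp add: s_def k_def)
  have tg: "t \<cdot> g = \<pi>"
    using Comp_assoc[OF pb(3) e(1) pi(2)] Comp_eq_Arr[OF v(3) pb(2) v(1) pi(2)] E(1)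
    by (simp add: t_def \<pi>_def)
  have pb': "is_pullback C s u k g"
  proof (rule is_pullbackI[OF st(1) u k pb(3) sg])
    fix W a b
    assume ab: "a \<in> Hom C W Y" "b \<in> Hom C W P" "s \<cdot> b = u \<cdot> a"
    \<comment> \<open>The second coordinate is forced to be \<open>t \<cdot> b\<close>, because
      \<open>t \<cdot> g = \<pi>\<close>.\<close>
    obtain c where c: "c \<in> Hom C W R" "\<rho>1 \<cdot> c = a" "\<rho>2 \<cdot> c = t \<cdot> b"
      using product_lift[OF R ab(1) Comp_in_Hom[OF ab(2) st(2)]] .
    have "e \<cdot> b = v \<cdot> c"
    proof (rule product_eqI[OF Q Comp_in_Hom[OF ab(2) e(1)] Comp_in_Hom[OF c(1) v(1)]])
      show "\<pi>1 \<cdot> (e \<cdot> b) = \<pi>1 \<cdot> (v \<cdot> c)"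
        using Comp_assoc[OF ab(2) e(1) pi(1)] ab(3) c(2)
          Comp_eq_Comp[OF v(2) c(1) v(1) pi(1) rho(1) u] by (simp add: s_def)
      show "\<pi>2 \<cdot> (e \<cdot> b) = \<pi>2 \<cdot> (v \<cdot> c)"
        using Comp_assoc[OF ab(2) e(1) pi(2)] c(3)
          Comp_eq_Arr[OF v(3) c(1) v(1) pi(2)] by (simp add: t_def)
    qed
    from pullback_lift[OF pb c(1) ab(2) this]
    obtain x where x: "x \<in> Hom C W E" "e' \<cdot> x = c" "g \<cdot> x = b" .
    then show "\<exists>x \<in> Hom C W E. k \<cdot> x = a \<and> g \<cdot> x = b"
      using Comp_assoc[OF x(1) pb(2) rho(1)] c(2) by (auto simp: k_def)
  next
    fix W x x'
    assume x: "x \<in> Hom C W E" "x' \<in> Hom C W E" "k \<cdot> x = k \<cdot> x'" "g \<cdot> x = g \<cdot> x'"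
    have "\<pi> \<cdot> x = \<pi> \<cdot> x'"
      using Comp_assoc[OF x(1) pb(3) st(2)] Comp_assoc[OF x(2) pb(3) st(2)] x(4) tg by simp
    then have "e' \<cdot> x = e' \<cdot> x'"
      using x(3) Comp_assoc[OF x(1) pb(2)] Comp_assoc[OF x(2) pb(2)] rho
      by (intro product_eqI[OF R Comp_in_Hom[OF x(1) pb(2)] Comp_in_Hom[OF x(2) pb(2)]])
        (auto simp: k_def \<pi>_def)
    then show "x = x'"
      using pullback_eqI[OF pb x(1,2)] x(4) by blast
  qed
  have k_Weq: "k \<in> Weq C"
    using acyclic_Fib_pullback[OF _ pb'] st(3) s_Weq by blast
  \<comment> \<open>The map \<open>w\<close> pairs the identity of \<open>Y\<close> with the
    constant path \<open>r \<cdot> u\<close>. It is a section of the acyclic \<open>k\<close>, hence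
    a weak equivalence.\<close>
  have "s \<cdot> (r \<cdot> u) = u \<cdot> Id C Y"
    using Comp_eq_Id[OF sr(1) u r(1) st(1)] Id_right[OF u] by simp
  from pullback_lift[OF pb' k pb(3) Id_in_Hom[OF ob(1)] Comp_in_Hom[OF u r(1)] this]
  obtain w where w: "w \<in> Hom C Y E" "k \<cdot> w = Id C Y" "g \<cdot> w = r \<cdot> u" .
  show thesis
  proof (rule that[OF w(1) _ \<pi>])
    show "w \<in> Weq C"
      using Weq_cancel_left[OF w(1) k] w(2) Id_acyclic[OF ob(1)] k_Weq by simp
    show "\<pi> \<cdot> w = u"
      using Comp_assoc[OF w(1) pb(3) st(2)] w(3) tg Comp_eq_Id[OF sr(2) u r(1) st(2)] by simp
  qed
qed

section \<open>Lifts with a strictly commuting lower triangle\<close>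

text \<open>The whole span is recorded, not just the lift \<open>v \<cdot> a\<close>: the homotopy
  in the upper triangle will come from comparing \<open>a \<cdot> f\<close> with \<open>w\<close>
  inside \<open>E\<close>.\<close>

lemma (in path_category) weak_lift_span:
  assumes m: "m \<in> Hom C A X" and f: "f \<in> Hom C A B" and p: "p \<in> Hom C X D"
    and n: "n \<in> Hom C B D" and sq: "p \<cdot> m = n \<cdot> f" and "f \<in> Weq C" "p \<in> Fib C"
  obtains E k v w a where "k \<in> Hom C E B" "k \<in> Fib C" "k \<in> Weq C" "v \<in> Hom C E X"
    "p \<cdot> v = n \<cdot> k" "w \<in> Hom C A E" "k \<cdot> w = f" "v \<cdot> w = m" "a \<in> Hom C B E" "k \<cdot> a = Id C B"
proof -
  obtain F q g where pb: "is_pullback C p n q g" "q \<in> Hom C F B" "g \<in> Hom C F X"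
    and F: "p \<cdot> g = n \<cdot> q" "q \<in> Fib C"
    using pullback_of_Fib[OF p n \<open>p \<in> Fib C\<close>] by metis
  obtain u where u: "u \<in> Hom C A F" "q \<cdot> u = f" "g \<cdot> u = m"
    using pullback_lift[OF pb f m sq] .
  obtain E w \<pi> where w: "w \<in> Hom C A E" "w \<in> Weq C"
    and \<pi>: "\<pi> \<in> Hom C E F" "\<pi> \<in> Fib C" "\<pi> \<cdot> w = u"
    using factorization[OF u(1)] .
  have k: "q \<cdot> \<pi> \<in> Hom C E B" "q \<cdot> \<pi> \<in> Fib C"
    using Comp_in_Hom[OF \<pi>(1) pb(2)] Fib_Comp[OF \<pi>(1) pb(2) \<pi>(2) F(2)] by auto
  have kw: "(q \<cdot> \<pi>) \<cdot> w = f"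
    using Comp_assoc[OF w(1) \<pi>(1) pb(2)] \<pi>(3) u(2) by simp
  have k_Weq: "q \<cdot> \<pi> \<in> Weq C"
    using Weq_cancel_right[OF w(1) k(1)] kw w(2) \<open>f \<in> Weq C\<close> by simp
  obtain a where a: "a \<in> Hom C B E" "(q \<cdot> \<pi>) \<cdot> a = Id C B"
    using acyclic_Fib_section[of "q \<cdot> \<pi>"] k k_Weq by (auto simp: Hom_iff)
  show thesis
  proof (rule that[OF k k_Weq _ _ w(1) kw _ a])
    show "g \<cdot> \<pi> \<in> Hom C E X"
      using Comp_in_Hom[OF \<pi>(1) pb(3)] .
    show "p \<cdot> (g \<cdot> \<pi>) = n \<cdot> (q \<cdot> \<pi>)"
      using Comp_eq_Comp[OF F(1) \<pi>(1) pb(3) p pb(2) n] .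
    show "(g \<cdot> \<pi>) \<cdot> w = m"
      using Comp_assoc[OF w(1) \<pi>(1) pb(3)] \<pi>(3) u(3) by simp
  qed
qed

lemma (in path_category) lower_lift:
  assumes "m \<in> Hom C A X" "f \<in> Hom C A B" "p \<in> Hom C X D" "n \<in> Hom C B D"
    "p \<cdot> m = n \<cdot> f" "f \<in> Weq C" "p \<in> Fib C"
  obtains l where "l \<in> Hom C B X" "p \<cdot> l = n"
proof -
  obtain E k v w a where k: "k \<in> Hom C E B" and v: "v \<in> Hom C E X" "p \<cdot> v = n \<cdot> k"
    and a: "a \<in> Hom C B E" "k \<cdot> a = Id C B"
    using weak_lift_span[OF assms] by metis
  have "p \<cdot> (v \<cdot> a) = n"
    using Comp_eq_Comp[OF v(2) a(1) v(1) assms(3) k assms(4)] a(2) Id_right[OF assms(4)] by simp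
  then show thesis
    using that Comp_in_Hom[OF a(1) v(1)] by blast
qed

section \<open>Kernel pairs and fibrewise path objects\<close>

text \<open>The diagonal \<open>d\<close> is a section of \<open>a\<close>, which is a pullback of
  \<open>k\<close>. So if \<open>k\<close> is acyclic, cancellation makes \<open>d\<close> a weak
  equivalence, and one can lift along it.\<close>

lemma (in path_category) kernel_pair:
  assumes k: "k \<in> Hom C X Y" "k \<in> Fib C"
  obtains E a b d where "is_pullback C k k a b" "a \<in> Hom C E X" "b \<in> Hom C E X"
    "k \<cdot> b = k \<cdot> a" "a \<in> Fib C" "b \<in> Fib C"
    "d \<in> Hom C X E" "a \<cdot> d = Id C X" "b \<cdot> d = Id C X" "k \<in> Weq C \<Longrightarrow> d \<in> Weq C"
proof -
  have ob: "X \<in> Ob C"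
    using Hom_Ob[OF k(1)] by auto
  obtain E a b where pb: "is_pullback C k k a b" "a \<in> Hom C E X" "b \<in> Hom C E X"
    and E: "k \<cdot> b = k \<cdot> a" "a \<in> Fib C" "k \<in> Weq C \<Longrightarrow> a \<in> Weq C"
    using pullback_of_Fib[OF k(1) k] by metis
  obtain d where d: "d \<in> Hom C X E" "a \<cdot> d = Id C X" "b \<cdot> d = Id C X"
    using pullback_lift[OF pb Id_in_Hom[OF ob] Id_in_Hom[OF ob] refl] .
  show thesis
  proof (rule that[OF pb E(1,2) _ d])
    show "b \<in> Fib C"
      using Fib_pullback[OF k(2) is_pullback_swap[OF pb]] .
    show "k \<in> Weq C \<Longrightarrow> d \<in> Weq C"
      using Weq_cancel_left[OF d(1) pb(2)] d(2) Id_acyclic[OF ob] E(3) by simp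
  qed
qed

text \<open>A path object for the fibration \<open>p : X \<rightarrow> D\<close>, presented in \<open>C\<close> rather than in \<open>C(D)\<close>: \<open>a, b\<close>
  are the projections of \<open>X \<times>\<^sub>D X\<close>, and its diagonal is \<open>e \<cdot> r\<close>.\<close>

definition fib_path ::
  "('o, 'm, 'z) path_cat_data_scheme \<Rightarrow> 'm \<Rightarrow> 'o \<Rightarrow> 'o \<Rightarrow> 'o \<Rightarrow> 'm \<Rightarrow> 'm \<Rightarrow> 'o \<Rightarrow> 'm \<Rightarrow> 'm \<Rightarrow> bool"
  where
  "fib_path C p X D E a b P r e \<longleftrightarrow>
     p \<in> Hom C X D \<and> p \<in> Fib C \<and> is_pullback C p p a b \<and> a \<in> Hom C E X \<and> b \<in> Hom C E X \<and>
     p \<cdot>\<^bsub>C\<^esub> b = p \<cdot>\<^bsub>C\<^esub> a \<and> a \<in> Fib C \<and> b \<in> Fib C \<and>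
     r \<in> Hom C X P \<and> r \<in> Weq C \<and> e \<in> Hom C P E \<and> e \<in> Fib C \<and>
     a \<cdot>\<^bsub>C\<^esub> (e \<cdot>\<^bsub>C\<^esub> r) = Id C X \<and> b \<cdot>\<^bsub>C\<^esub> (e \<cdot>\<^bsub>C\<^esub> r) = Id C X"

text \<open>Factor the diagonal of the kernel pair of \<open>p\<close>.\<close>

lemma (in path_category) fib_path_exists:
  assumes "p \<in> Hom C X D" "p \<in> Fib C"
  obtains E a b P r e where "fib_path C p X D E a b P r e"
proof -
  obtain E a b d where *: "is_pullback C p p a b" "a \<in> Hom C E X" "b \<in> Hom C E X"
    "p \<cdot> b = p \<cdot> a" "a \<in> Fib C" "b \<in> Fib C"
    and d: "d \<in> Hom C X E" "a \<cdot> d = Id C X" "b \<cdot> d = Id C X"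
    using kernel_pair[OF assms] by metis
  obtain P r e where "r \<in> Hom C X P" "r \<in> Weq C" "e \<in> Hom C P E" "e \<in> Fib C" "e \<cdot> r = d"
    using factorization[OF d(1)] .
  then have "fib_path C p X D E a b P r e"
    using assms * d unfolding fib_path_def by auto
  then show thesis
    using that by blast
qed

text \<open>Extends a homotopy along a weak equivalence: \<open>lower_lift\<close> is applied to the
  fibration \<open>e\<close>, with \<open>h\<close> on top and the pair of \<open>x\<close> and
  \<open>y\<close> at the bottom. Only the endpoints of \<open>j\<close> are controlled;
  \<open>j \<cdot> c\<close> may differ from \<open>h\<close>.\<close>

lemma (in path_category) fib_path_lift:
  assumes fp: "fib_path C p X D E a b P r e"
    and c: "c \<in> Hom C W Z" "c \<in> Weq C" and xy: "x \<in> Hom C Z X" "y \<in> Hom C Z X" "p \<cdot> x = p \<cdot> y"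
    and h: "h \<in> Hom C W P" "a \<cdot> (e \<cdot> h) = x \<cdot> c" "b \<cdot> (e \<cdot> h) = y \<cdot> c"
  obtains j where "j \<in> Hom C Z P" "a \<cdot> (e \<cdot> j) = x" "b \<cdot> (e \<cdot> j) = y"
proof -
  have pb: "is_pullback C p p a b" "a \<in> Hom C E X" "b \<in> Hom C E X"
    and e: "e \<in> Hom C P E" "e \<in> Fib C"
    using fp unfolding fib_path_def by auto
  obtain z where z: "z \<in> Hom C Z E" "a \<cdot> z = x" "b \<cdot> z = y"
    using pullback_lift[OF pb xy(1,2)] xy(3) by metis
  have "e \<cdot> h = z \<cdot> c"
    using Comp_assoc[OF c(1) z(1)] pb(2,3) z(2,3) h(2,3)
    by (intro pullback_eqI[OF pb Comp_in_Hom[OF h(1) e(1)] Comp_in_Hom[OF c(1) z(1)]]) auto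
  then obtain j where "j \<in> Hom C Z P" "e \<cdot> j = z"
    using lower_lift[OF h(1) c(1) e(1) z(1) _ c(2) e(2)] by blast
  then show thesis
    using that z by blast
qed

text \<open>The case in which the given homotopy is constant, namely
  \<open>r \<cdot> (x \<cdot> c)\<close>.\<close>

lemma (in path_category) fib_path_lift_refl:
  assumes fp: "fib_path C p X D E a b P r e"
    and c: "c \<in> Hom C W Z" "c \<in> Weq C" and xy: "x \<in> Hom C Z X" "y \<in> Hom C Z X" "p \<cdot> x = p \<cdot> y"
    and eq: "x \<cdot> c = y \<cdot> c"
  obtains j where "j \<in> Hom C Z P" "a \<cdot> (e \<cdot> j) = x" "b \<cdot> (e \<cdot> j) = y"
proof -
  have *: "a \<in> Hom C E X" "b \<in> Hom C E X" "e \<in> Hom C P E" "r \<in> Hom C X P"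
    "a \<cdot> (e \<cdot> r) = Id C X" "b \<cdot> (e \<cdot> r) = Id C X"
    using fp unfolding fib_path_def by auto
  have xc: "x \<cdot> c \<in> Hom C W X"
    using Comp_in_Hom[OF c(1) xy(1)] .
  have "e \<cdot> (r \<cdot> (x \<cdot> c)) = (e \<cdot> r) \<cdot> (x \<cdot> c)"
    using Comp_assoc[OF xc *(4,3)] by simp
  then have "a \<cdot> (e \<cdot> (r \<cdot> (x \<cdot> c))) = x \<cdot> c" "b \<cdot> (e \<cdot> (r \<cdot> (x \<cdot> c))) = y \<cdot> c"
    using Comp_eq_Id[OF *(5) xc Comp_in_Hom[OF *(4,3)] *(1)]
      Comp_eq_Id[OF *(6) xc Comp_in_Hom[OF *(4,3)] *(2)] eq by auto
  then show thesis
    using fib_path_lift[OF fp c xy Comp_in_Hom[OF xc *(4)]] that by blast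
qed

section \<open>Path objects in the slice and homotopies in the ambient category\<close>

lemma fib_over_Hom_iff:
  "x \<in> Hom (fib_over C D) q q' \<longleftrightarrow> (\<exists>f. x = (q, f, q') \<and> q \<in> Fib C \<and> Cod C q = D \<and>
     q' \<in> Fib C \<and> Cod C q' = D \<and> f \<in> Hom C (Dom C q) (Dom C q') \<and> q' \<cdot>\<^bsub>C\<^esub> f = q)"
  by (auto simp: Hom_def fib_over_def Let_def)

lemma fib_over_simps:
  "Id (fib_over C D) q = (q, Id C (Dom C q), q)"
  "(q', g, q'') \<cdot>\<^bsub>fib_over C D\<^esub> (q, f, q') = (q, g \<cdot>\<^bsub>C\<^esub> f, q'')"
  by (auto simp: fib_over_def Let_def)

lemma fib_over_WeqD: "(q, f, q') \<in> Weq (fib_over C D) \<Longrightarrow> f \<in> Weq C"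
  by (auto simp: fib_over_def Let_def)

lemma fib_over_FibI:
    "(q, f, q') \<in> Hom (fib_over C D) q q' \<Longrightarrow> f \<in> Fib C \<Longrightarrow> (q, f, q') \<in> Fib (fib_over C D)"
  and fib_over_WeqI:
    "(q, f, q') \<in> Hom (fib_over C D) q q' \<Longrightarrow> f \<in> Weq C \<Longrightarrow> (q, f, q') \<in> Weq (fib_over C D)"
  by (auto simp: fib_over_def Let_def Hom_def)

text \<open>Translates slice data into maps of \<open>C\<close>. A weak equivalence \<open>R\<close>
  that is a common section of two maps \<open>S\<close>, \<open>T\<close> over the base is what
  \<open>fib_path_lift_refl\<close> takes as input to map this path object to another one.\<close>

lemma (in path_category) fib_over_path_objectE:
  assumes "is_path_object (fib_over C D) p q r s t"
  obtains R S T where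
    "R \<in> Hom C (Dom C p) (Dom C q)" "R \<in> Weq C" "underlying s = S" "underlying t = T"
    "S \<in> Hom C (Dom C q) (Dom C p)" "T \<in> Hom C (Dom C q) (Dom C p)"
    "p \<cdot> S = q" "p \<cdot> T = q" "S \<cdot> R = Id C (Dom C p)" "T \<cdot> R = Id C (Dom C p)"
proof -
  obtain Q \<pi>1 \<pi>2 d e where r: "r \<in> Hom (fib_over C D) p q" "r \<in> Weq (fib_over C D)"
    and pi: "\<pi>1 \<in> Hom (fib_over C D) Q p" "\<pi>2 \<in> Hom (fib_over C D) Q p"
    and d: "d \<in> Hom (fib_over C D) p Q" "\<pi>1 \<cdot>\<^bsub>fib_over C D\<^esub> d = Id (fib_over C D) p"
      "\<pi>2 \<cdot>\<^bsub>fib_over C D\<^esub> d = Id (fib_over C D) p"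
    and e: "e \<in> Hom (fib_over C D) q Q" "\<pi>1 \<cdot>\<^bsub>fib_over C D\<^esub> e = s" "\<pi>2 \<cdot>\<^bsub>fib_over C D\<^esub> e = t"
      "e \<cdot>\<^bsub>fib_over C D\<^esub> r = d"
    using assms unfolding is_path_object_def is_product_def by blast
  obtain r0 where r0: "r = (p, r0, q)" "p \<in> Fib C" "r0 \<in> Hom C (Dom C p) (Dom C q)"
    using r(1) unfolding fib_over_Hom_iff by blast
  obtain a where a: "\<pi>1 = (Q, a, p)" "a \<in> Hom C (Dom C Q) (Dom C p)" "p \<cdot> a = Q"
    using pi(1) unfolding fib_over_Hom_iff by blast
  obtain b where b: "\<pi>2 = (Q, b, p)" "b \<in> Hom C (Dom C Q) (Dom C p)" "p \<cdot> b = Q"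
    using pi(2) unfolding fib_over_Hom_iff by blast
  obtain d0 where d0: "d = (p, d0, Q)"
    using d(1) unfolding fib_over_Hom_iff by blast
  obtain e0 where e0: "e = (q, e0, Q)" "e0 \<in> Hom C (Dom C q) (Dom C Q)" "Q \<cdot> e0 = q"
    using e(1) unfolding fib_over_Hom_iff by blast
  note eqs = r0(1) a(1) b(1) d0 e0(1)
  have p: "p \<in> Hom C (Dom C p) (Cod C p)"
    using r0(2) Fib_subset by (auto simp: Hom_iff)
  have diag: "a \<cdot> d0 = Id C (Dom C p)" "b \<cdot> d0 = Id C (Dom C p)" "e0 \<cdot> r0 = d0"
    using d(2,3) e(4) by (simp_all add: eqs fib_over_simps)
  have st: "underlying s = a \<cdot> e0" "underlying t = b \<cdot> e0"
    unfolding e(2,3)[symmetric] by (simp_all add: eqs fib_over_simps underlying_def)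
  show thesis
  proof (rule that[OF r0(3) _ st])
    show "r0 \<in> Weq C"
      using r(2) unfolding eqs(1) by (rule fib_over_WeqD)
    show "a \<cdot> e0 \<in> Hom C (Dom C q) (Dom C p)" "b \<cdot> e0 \<in> Hom C (Dom C q) (Dom C p)"
      by (rule Comp_in_Hom[OF e0(2)], fact a b)+
    show "p \<cdot> (a \<cdot> e0) = q" "p \<cdot> (b \<cdot> e0) = q"
      using Comp_eq_Arr[OF a(3) e0(2) a(2) p] Comp_eq_Arr[OF b(3) e0(2) b(2) p] e0(3) by simp_all
    show "(a \<cdot> e0) \<cdot> r0 = Id C (Dom C p)" "(b \<cdot> e0) \<cdot> r0 = Id C (Dom C p)"
      using Comp_assoc[OF r0(3) e0(2) a(2)] Comp_assoc[OF r0(3) e0(2) b(2)] diag by simp_all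
  qed
qed

text \<open>The kernel pair of \<open>p\<close> is the product of \<open>p\<close> with itself in
  the slice. The structure maps \<open>q\<close> of \<open>E\<close> and \<open>u\<close> of
  \<open>P\<close> are composites of fibrations, hence objects of the slice.\<close>

lemma (in path_category) fib_path_is_path_object:
  assumes "fib_path C p X D E a b P r e"
  defines "q \<equiv> p \<cdot> a"
  defines "u \<equiv> q \<cdot> e"
  shows "is_path_object (fib_over C D) p u (p, r, u) (u, a \<cdot> e, p) (u, b \<cdot> e, p)"
proof -
  let ?F = "fib_over C D"
  have p: "p \<in> Hom C X D" "p \<in> Fib C" "p \<in> Arr C" "Dom C p = X" "Cod C p = D"
    and pb: "is_pullback C p p a b" "a \<in> Hom C E X" "b \<in> Hom C E X" "a \<in> Fib C" "b \<in> Fib C"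
    and pba: "p \<cdot> b = q"
    and r: "r \<in> Hom C X P" "r \<in> Weq C" and e: "e \<in> Hom C P E" "e \<in> Fib C"
    and er: "a \<cdot> (e \<cdot> r) = Id C X" "b \<cdot> (e \<cdot> r) = Id C X"
    using assms(1) by (auto simp: fib_path_def Hom_iff q_def)
  have q: "q \<in> Hom C E D" "q \<in> Fib C" "Dom C q = E" "Cod C q = D"
    using Comp_in_Hom[OF pb(2) p(1)] Fib_Comp[OF pb(2) p(1) pb(4) p(2)]
    by (auto simp: q_def Hom_iff)
  have u: "u \<in> Hom C P D" "u \<in> Fib C" "Dom C u = P" "Cod C u = D"
    using Comp_in_Hom[OF e(1) q(1)] Fib_Comp[OF e(1) q(1) e(2) q(2)] by (auto simp: u_def Hom_iff)
  have er_Hom: "e \<cdot> r \<in> Hom C X E"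
    using Comp_in_Hom[OF r(1) e(1)] .
  have qer: "q \<cdot> (e \<cdot> r) = p"
    using Comp_assoc[OF er_Hom pb(2) p(1)] er(1) Id_right[OF p(1)] by (simp add: q_def)
  have ur: "u \<cdot> r = p"
    using Comp_assoc[OF r(1) e(1) q(1)] qer by (simp add: u_def)
  have homs: "(q, a, p) \<in> Hom ?F q p" "(q, b, p) \<in> Hom ?F q p" "(p, r, u) \<in> Hom ?F p u"
    "(u, e, q) \<in> Hom ?F u q" "(p, e \<cdot> r, q) \<in> Hom ?F p q"
    using p q u pb r e pba qer ur er_Hom
    by (auto simp: fib_over_Hom_iff q_def[symmetric] u_def[symmetric])
  have prod: "is_product ?F p p q (q, a, p) (q, b, p)"
    unfolding is_product_def
  proof (intro conjI allI ballI)
    fix W x y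
    assume "x \<in> Hom ?F W p" "y \<in> Hom ?F W p"
    then obtain x0 y0 where xy: "x = (W, x0, p)" "y = (W, y0, p)" and W: "W \<in> Fib C" "Cod C W = D"
      and xy0: "x0 \<in> Hom C (Dom C W) X" "p \<cdot> x0 = W" "y0 \<in> Hom C (Dom C W) X" "p \<cdot> y0 = W"
      using p(4) by (auto simp: fib_over_Hom_iff)
    obtain z where z: "z \<in> Hom C (Dom C W) E" "a \<cdot> z = x0" "b \<cdot> z = y0"
      using pullback_lift[OF pb(1-3) xy0(1,3)] xy0 by metis
    have "q \<cdot> z = W"
      using Comp_assoc[OF z(1) pb(2) p(1)] z(2) xy0(2) by (simp add: q_def)
    then have z_Hom: "(W, z, q) \<in> Hom ?F W q"
      using W q z(1) by (auto simp: fib_over_Hom_iff)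
    show "\<exists>!z. z \<in> Hom ?F W q \<and> (q, a, p) \<cdot>\<^bsub>?F\<^esub> z = x \<and> (q, b, p) \<cdot>\<^bsub>?F\<^esub> z = y"
    proof (rule ex1I[of _ "(W, z, q)"])
      fix z'
      assume z': "z' \<in> Hom ?F W q \<and> (q, a, p) \<cdot>\<^bsub>?F\<^esub> z' = x \<and> (q, b, p) \<cdot>\<^bsub>?F\<^esub> z' = y"
      obtain z0 where z0: "z' = (W, z0, q)" "z0 \<in> Hom C (Dom C W) E"
        using z' unfolding fib_over_Hom_iff q(3) by blast
      then have "a \<cdot> z0 = a \<cdot> z" "b \<cdot> z0 = b \<cdot> z"
        using z' z(2,3) by (simp_all add: xy fib_over_simps)
      then show "z' = (W, z, q)"
        using pullback_eqI[OF pb(1-3) z0(2) z(1)] z0(1) by simp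
    qed (simp add: z_Hom xy fib_over_simps z(2,3))
  qed (fact homs)+
  show ?thesis
    unfolding is_path_object_def
  proof (intro conjI exI)
    show "is_product ?F p p q (q, a, p) (q, b, p)" "(p, e \<cdot> r, q) \<in> Hom ?F p q"
      "(p, r, u) \<in> Hom ?F p u" "(u, e, q) \<in> Hom ?F u q"
      by (fact prod homs)+
    show "(p, r, u) \<in> Weq ?F" "(u, e, q) \<in> Fib ?F"
      using fib_over_WeqI[OF homs(3) r(2)] fib_over_FibI[OF homs(4) e(2)] by auto
  qed (auto simp: fib_over_simps er p(4))
qed

text \<open>Independence of the path object: the definition allows any path object in the slice,
  while later arguments need all homotopies to live in one fixed \<open>P\<close>.\<close>

lemma (in path_category) fib_homotopic_iff:
  assumes fp: "fib_path C p X D E a b P r e"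
    and fg: "f \<in> Hom C W X" "g \<in> Hom C W X"
  shows "fib_homotopic C p f g \<longleftrightarrow>
    p \<cdot> f = p \<cdot> g \<and> (\<exists>h \<in> Hom C W P. a \<cdot> (e \<cdot> h) = f \<and> b \<cdot> (e \<cdot> h) = g)"
    (is "?L \<longleftrightarrow> ?R")
proof
  have p: "p \<in> Hom C X D" "p \<in> Fib C" "Dom C p = X" "Cod C p = D"
    and ab: "a \<in> Hom C E X" "b \<in> Hom C E X" and e: "e \<in> Hom C P E"
    using fp by (auto simp: fib_path_def Hom_iff)
  have fW: "Dom C f = W"
    using fg(1) by (simp add: Hom_iff)
  assume ?L
  then obtain PX r' s t h where pgf: "p \<cdot> f = p \<cdot> g"
    and po: "is_path_object (fib_over C D) p PX r' s t"
    and h: "h \<in> Hom C W (Dom C PX)" "underlying s \<cdot> h = f" "underlying t \<cdot> h = g"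
    unfolding fib_homotopic_def p(4) fW by blast
  obtain R S T where rst: "R \<in> Hom C X (Dom C PX)" "R \<in> Weq C" "underlying s = S" "underlying t = T"
    "S \<in> Hom C (Dom C PX) X" "T \<in> Hom C (Dom C PX) X" "p \<cdot> S = PX" "p \<cdot> T = PX"
    "S \<cdot> R = Id C X" "T \<cdot> R = Id C X"
    using fib_over_path_objectE[OF po, unfolded p(3)] .
  \<comment> \<open>\<open>S\<close> and \<open>T\<close> agree after \<open>R\<close>, so lifting
    along \<open>R\<close> gives a comparison map \<open>j\<close> that preserves both endpoints;
    composing with it carries homotopies into \<open>P\<close>.\<close>
  obtain j where j: "j \<in> Hom C (Dom C PX) P" "a \<cdot> (e \<cdot> j) = S" "b \<cdot> (e \<cdot> j) = T"
    using fib_path_lift_refl[OF fp rst(1,2,5,6) trans[OF rst(7) rst(8)[symmetric]]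
        trans[OF rst(9) rst(10)[symmetric]]] .
  have "a \<cdot> (e \<cdot> (j \<cdot> h)) = f" "b \<cdot> (e \<cdot> (j \<cdot> h)) = g"
    using Comp_assoc[OF h(1) j(1) e] Comp_assoc[OF h(1) Comp_in_Hom[OF j(1) e] ab(1)]
      Comp_assoc[OF h(1) Comp_in_Hom[OF j(1) e] ab(2)] j(2,3) h(2,3) rst(3,4) by simp_all
  then show ?R
    using pgf Comp_in_Hom[OF h(1) j(1)] by blast
next
  assume ?R
  then obtain h where h: "h \<in> Hom C W P" "a \<cdot> (e \<cdot> h) = f" "b \<cdot> (e \<cdot> h) = g"
    and pfg: "p \<cdot> f = p \<cdot> g"
    by blast
  have p: "p \<in> Hom C X D" "p \<in> Fib C" "Dom C p = X" "Cod C p = D"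
    and ab: "a \<in> Hom C E X" "b \<in> Hom C E X" and e: "e \<in> Hom C P E"
    using fp by (auto simp: fib_path_def Hom_iff)
  have "(a \<cdot> e) \<cdot> h = f" "(b \<cdot> e) \<cdot> h = g"
    using Comp_assoc[OF h(1) e] ab h(2,3) by auto
  then have st: "underlying ((p \<cdot> a) \<cdot> e, a \<cdot> e, p) \<cdot> h = f"
    "underlying ((p \<cdot> a) \<cdot> e, b \<cdot> e, p) \<cdot> h = g"
    by (simp_all add: underlying_def)
  have dom: "Dom C ((p \<cdot> a) \<cdot> e) = P" "Dom C f = W"
    using Comp_in_Hom[OF e Comp_in_Hom[OF ab(1) p(1)]] fg(1) by (auto simp: Hom_iff)
  have "h \<in> Hom C W (Dom C ((p \<cdot> a) \<cdot> e))"
    using h(1) dom(1) by simp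
  then show ?L
    unfolding fib_homotopic_def p(3,4) dom(2)
    using p(2) fg pfg st fib_path_is_path_object[OF fp] by (intro conjI exI)
qed

section \<open>Composing homotopies; existence and uniqueness of the lift\<close>

text \<open>Symmetry and transitivity in one construction. The two homotopies form a map
  \<open>z\<close> into the object \<open>F\<close> of pairs of paths with a common target, and a
  map \<open>j\<close> from \<open>F\<close> to \<open>P\<close> turns such a pair into a path
  between the sources.\<close>

lemma (in path_category) fib_homotopic_common_target:
  assumes p: "p \<in> Hom C X D" "p \<in> Fib C"
    and f: "f \<in> Hom C W X" "f' \<in> Hom C W X" "g \<in> Hom C W X"
    and hom: "fib_homotopic C p f g" "fib_homotopic C p f' g"
  shows "fib_homotopic C p f f'"
proof -
  obtain E a b P r e where fp: "fib_path C p X D E a b P r e"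
    using fib_path_exists[OF p] .
  have ab: "a \<in> Hom C E X" "b \<in> Hom C E X" "p \<cdot> b = p \<cdot> a" "b \<in> Fib C"
    and e: "e \<in> Hom C P E" "e \<in> Fib C" and r: "r \<in> Hom C X P" "r \<in> Weq C"
    and diag: "a \<cdot> (e \<cdot> r) = Id C X" "b \<cdot> (e \<cdot> r) = Id C X"
    using fp unfolding fib_path_def by auto
  obtain h h' where pf: "p \<cdot> f = p \<cdot> g" "p \<cdot> f' = p \<cdot> g"
    and h: "h \<in> Hom C W P" "a \<cdot> (e \<cdot> h) = f" "b \<cdot> (e \<cdot> h) = g"
    and h': "h' \<in> Hom C W P" "a \<cdot> (e \<cdot> h') = f'" "b \<cdot> (e \<cdot> h') = g"
    using hom fib_homotopic_iff[OF fp f(1,3)] fib_homotopic_iff[OF fp f(2,3)] by auto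
  define s t where "s = a \<cdot> e" and "t = b \<cdot> e"
  have st: "s \<in> Hom C P X" "t \<in> Hom C P X" "t \<in> Fib C"
    using Comp_in_Hom[OF e(1)] Fib_Comp[OF e(1) _ e(2)] ab by (auto simp: s_def t_def)
  have s_Comp: "s \<cdot> y = a \<cdot> (e \<cdot> y)" "t \<cdot> y = b \<cdot> (e \<cdot> y)" if "y \<in> Hom C V P" for y V
    using Comp_assoc[OF that e(1)] ab by (auto simp: s_def t_def)
  have ps: "p \<cdot> s = p \<cdot> t"
    using Comp_eq_Comp[OF ab(3) e(1) ab(2) p(1) ab(1) p(1)] by (simp add: s_def t_def)
  \<comment> \<open>With \<open>t\<close> acyclic, the diagonal of its kernel pair \<open>F\<close>
    is a weak equivalence.\<close>
  have "t \<in> Weq C"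
    using Weq_cancel_right[OF r(1) st(2)] s_Comp[OF r(1)] diag(2) r(2)
      Id_acyclic[OF Hom_Ob(1)[OF r(1)]] by simp
  then obtain F c c' d where pb: "is_pullback C t t c c'" "c \<in> Hom C F P" "c' \<in> Hom C F P"
    and F: "t \<cdot> c' = t \<cdot> c"
    and d: "d \<in> Hom C P F" "c \<cdot> d = Id C P" "c' \<cdot> d = Id C P" "d \<in> Weq C"
    using kernel_pair[OF st(2,3)] by metis
  have sc: "s \<cdot> c \<in> Hom C F X" "s \<cdot> c' \<in> Hom C F X"
    using Comp_in_Hom st(1) pb(2,3) by auto
  have psc: "p \<cdot> (s \<cdot> c) = p \<cdot> (s \<cdot> c')"
    using Comp_eq_Comp[OF ps pb(2) st(1) p(1) st(2) p(1)]
      Comp_eq_Comp[OF ps pb(3) st(1) p(1) st(2) p(1)] F by simp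
  \<comment> \<open>On the pairs of constant paths, given by the weak equivalence
    \<open>d \<cdot> r\<close>, the two sources agree. Lifting along it produces
    \<open>j\<close>.\<close>
  have "c \<cdot> (d \<cdot> r) = r" "c' \<cdot> (d \<cdot> r) = r"
    using Comp_eq_Id[OF d(2) r(1) d(1) pb(2)] Comp_eq_Id[OF d(3) r(1) d(1) pb(3)] by auto
  then have "(s \<cdot> c) \<cdot> (d \<cdot> r) = (s \<cdot> c') \<cdot> (d \<cdot> r)"
    using Comp_assoc[OF Comp_in_Hom[OF r(1) d(1)] pb(2) st(1)]
      Comp_assoc[OF Comp_in_Hom[OF r(1) d(1)] pb(3) st(1)] by simp
  then obtain j where j: "j \<in> Hom C F P" "a \<cdot> (e \<cdot> j) = s \<cdot> c" "b \<cdot> (e \<cdot> j) = s \<cdot> c'"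
    using fib_path_lift_refl[OF fp Comp_in_Hom[OF r(1) d(1)]
        Weq_Comp[OF r(1) d(1) r(2) d(4)] sc psc] by metis
  obtain z where z: "z \<in> Hom C W F" "c \<cdot> z = h" "c' \<cdot> z = h'"
    using pullback_lift[OF pb h(1) h'(1)] s_Comp[OF h(1)] s_Comp[OF h'(1)] h(3) h'(3) by metis
  have "a \<cdot> (e \<cdot> (j \<cdot> z)) = (a \<cdot> (e \<cdot> j)) \<cdot> z" "b \<cdot> (e \<cdot> (j \<cdot> z)) = (b \<cdot> (e \<cdot> j)) \<cdot> z"
    using Comp_assoc[OF z(1) j(1) e(1)] Comp_assoc[OF z(1) Comp_in_Hom[OF j(1) e(1)]] ab by auto
  then have "a \<cdot> (e \<cdot> (j \<cdot> z)) = f" "b \<cdot> (e \<cdot> (j \<cdot> z)) = f'"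
    using j(2,3) Comp_assoc[OF z(1) pb(2) st(1)] Comp_assoc[OF z(1) pb(3) st(1)] z(2,3)
      s_Comp[OF h(1)] s_Comp[OF h'(1)] h(2) h'(2) by auto
  then show ?thesis
    using fib_homotopic_iff[OF fp f(1,2)] pf Comp_in_Hom[OF z(1) j(1)] by auto
qed

text \<open>The lift is \<open>v \<cdot> s\<close>, for a section \<open>s\<close> of the acyclic
  fibration \<open>k\<close>. Both \<open>s \<cdot> f\<close> and \<open>w\<close> lie over
  \<open>f\<close>, and any two maps into \<open>E\<close> with the same composite with
  \<open>k\<close> become homotopic over \<open>D\<close> after applying \<open>v\<close>.\<close>

lemma (in path_category) weak_lift_exists:
  assumes "m \<in> Hom C A X" "f \<in> Hom C A B" "p \<in> Hom C X D" "n \<in> Hom C B D"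
    "p \<cdot> m = n \<cdot> f" "f \<in> Weq C" "p \<in> Fib C"
  shows "\<exists>l \<in> Hom C B X. p \<cdot> l = n \<and> fib_homotopic C p (l \<cdot> f) m"
proof -
  obtain E k v w s where k: "k \<in> Hom C E B" "k \<in> Fib C" "k \<in> Weq C"
    and v: "v \<in> Hom C E X" "p \<cdot> v = n \<cdot> k"
    and w: "w \<in> Hom C A E" "k \<cdot> w = f" "v \<cdot> w = m"
    and s: "s \<in> Hom C B E" "k \<cdot> s = Id C B"
    using weak_lift_span[OF assms] by metis
  have l: "v \<cdot> s \<in> Hom C B X"
    using Comp_in_Hom[OF s(1) v(1)] .
  have pl: "p \<cdot> (v \<cdot> s) = n"
    using Comp_eq_Comp[OF v(2) s(1) v(1) assms(3) k(1) assms(4)] s(2) Id_right[OF assms(4)] by simp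
  have lf: "(v \<cdot> s) \<cdot> f = v \<cdot> (s \<cdot> f)"
    using Comp_assoc[OF assms(2) s(1) v(1)] .
  have sf: "s \<cdot> f \<in> Hom C A E" "k \<cdot> (s \<cdot> f) = f"
    using Comp_in_Hom[OF assms(2) s(1)] Comp_eq_Id[OF s(2) assms(2) s(1) k(1)] by auto
  obtain F c c' d where pb: "is_pullback C k k c c'" "c \<in> Hom C F E" "c' \<in> Hom C F E"
    and F: "k \<cdot> c' = k \<cdot> c"
    and d: "d \<in> Hom C E F" "c \<cdot> d = Id C E" "c' \<cdot> d = Id C E" "d \<in> Weq C"
    using kernel_pair[OF k(1,2)] k(3) by metis
  obtain G a b P r e where fp: "fib_path C p X D G a b P r e"
    using fib_path_exists[OF assms(3,7)] .
  have ab: "a \<in> Hom C G X" "b \<in> Hom C G X" and e: "e \<in> Hom C P G"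
    using fp unfolding fib_path_def by auto
  have vc: "v \<cdot> c \<in> Hom C F X" "v \<cdot> c' \<in> Hom C F X"
    using Comp_in_Hom v(1) pb(2,3) by auto
  have pvc: "p \<cdot> (v \<cdot> c) = p \<cdot> (v \<cdot> c')"
    using Comp_eq_Comp[OF v(2) pb(2) v(1) assms(3) k(1) assms(4)]
      Comp_eq_Comp[OF v(2) pb(3) v(1) assms(3) k(1) assms(4)] F by simp
  \<comment> \<open>The universal case lives on the kernel pair \<open>F\<close> of
    \<open>k\<close>: the two maps to \<open>X\<close> agree on the diagonal, a weak equivalence, so
    a homotopy \<open>j\<close> between them exists.\<close>
  have "(v \<cdot> c) \<cdot> d = (v \<cdot> c') \<cdot> d"
    using Comp_assoc[OF d(1) pb(2) v(1)] Comp_assoc[OF d(1) pb(3) v(1)] d(2,3) by simp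
  then obtain j where j: "j \<in> Hom C F P" "a \<cdot> (e \<cdot> j) = v \<cdot> c" "b \<cdot> (e \<cdot> j) = v \<cdot> c'"
    using fib_path_lift_refl[OF fp d(1,4) vc pvc] by metis
  \<comment> \<open>Restricting \<open>j\<close> along the pair of \<open>s \<cdot> f\<close> and
    \<open>w\<close> gives a homotopy ending at \<open>v \<cdot> w = m\<close>.\<close>
  obtain z where z: "z \<in> Hom C A F" "c \<cdot> z = s \<cdot> f" "c' \<cdot> z = w"
    using pullback_lift[OF pb sf(1) w(1)] sf(2) w(2) by metis
  have "a \<cdot> (e \<cdot> (j \<cdot> z)) = (a \<cdot> (e \<cdot> j)) \<cdot> z" "b \<cdot> (e \<cdot> (j \<cdot> z)) = (b \<cdot> (e \<cdot> j)) \<cdot> z"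
    using Comp_assoc[OF z(1) j(1) e] Comp_assoc[OF z(1) Comp_in_Hom[OF j(1) e]] ab by auto
  then have "a \<cdot> (e \<cdot> (j \<cdot> z)) = (v \<cdot> s) \<cdot> f" "b \<cdot> (e \<cdot> (j \<cdot> z)) = m"
    using j(2,3) Comp_assoc[OF z(1) pb(2) v(1)] Comp_assoc[OF z(1) pb(3) v(1)] z(2,3) lf w(3)
    by auto
  moreover have "p \<cdot> ((v \<cdot> s) \<cdot> f) = p \<cdot> m"
    using Comp_assoc[OF assms(2) l assms(3)] pl assms(5) by simp
  ultimately have "fib_homotopic C p ((v \<cdot> s) \<cdot> f) m"
    using fib_homotopic_iff[OF fp Comp_in_Hom[OF assms(2) l] assms(1)]
      Comp_in_Hom[OF z(1) j(1)] by auto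
  then show ?thesis
    using l pl by blast
qed

text \<open>Weak equivalences can be cancelled on the right up to fibrewise homotopy, since
  \<open>fib_path_lift\<close> extends the homotopy along \<open>f\<close>.\<close>

lemma (in path_category) weak_lift_unique:
  assumes p: "p \<in> Hom C X D" "p \<in> Fib C" and f: "f \<in> Hom C A B" "f \<in> Weq C"
    and l: "l \<in> Hom C B X" "l' \<in> Hom C B X" "p \<cdot> l = p \<cdot> l'"
    and hom: "fib_homotopic C p (l \<cdot> f) (l' \<cdot> f)"
  shows "fib_homotopic C p l l'"
proof -
  obtain E a b P r e where fp: "fib_path C p X D E a b P r e"
    using fib_path_exists[OF p] .
  obtain h where h: "h \<in> Hom C A P" "a \<cdot> (e \<cdot> h) = l \<cdot> f" "b \<cdot> (e \<cdot> h) = l' \<cdot> f"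
    using hom fib_homotopic_iff[OF fp Comp_in_Hom[OF f(1) l(1)] Comp_in_Hom[OF f(1) l(2)]] by auto
  obtain j where "j \<in> Hom C B P" "a \<cdot> (e \<cdot> j) = l" "b \<cdot> (e \<cdot> j) = l'"
    using fib_path_lift[OF fp f l h] .
  then show ?thesis
    using fib_homotopic_iff[OF fp l(1,2)] l(3) by auto
qed

theorem theorem2p38:
  fixes \<C> :: "('o, 'm, 'z) path_cat_data_scheme"
    and A B C D :: 'o
    and m f p n :: 'm
  assumes "path_category \<C>"
    and "m \<in> Hom \<C> A C"
    and "f \<in> Hom \<C> A B"
    and "p \<in> Hom \<C> C D"
    and "n \<in> Hom \<C> B D"
    and "p \<cdot>\<^bsub>\<C>\<^esub> m = n \<cdot>\<^bsub>\<C>\<^esub> f"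
    and "f \<in> Weq \<C>"
    and "p \<in> Fib \<C>"
  shows "(\<exists>l \<in> Hom \<C> B C. p \<cdot>\<^bsub>\<C>\<^esub> l = n \<and> fib_homotopic \<C> p (l \<cdot>\<^bsub>\<C>\<^esub> f) m) \<and>
    (\<forall>l \<in> Hom \<C> B C. \<forall>l' \<in> Hom \<C> B C.
       p \<cdot>\<^bsub>\<C>\<^esub> l = n \<and> fib_homotopic \<C> p (l \<cdot>\<^bsub>\<C>\<^esub> f) m \<and>
       p \<cdot>\<^bsub>\<C>\<^esub> l' = n \<and> fib_homotopic \<C> p (l' \<cdot>\<^bsub>\<C>\<^esub> f) m \<longrightarrow>
       fib_homotopic \<C> p l l')"
proof -
  interpret path_category \<C>
    by (rule assms(1))
  have "fib_homotopic \<C> p l l'"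
    if l: "l \<in> Hom \<C> B C" "l' \<in> Hom \<C> B C" "p \<cdot>\<^bsub>\<C>\<^esub> l = n" "p \<cdot>\<^bsub>\<C>\<^esub> l' = n"
      and hom: "fib_homotopic \<C> p (l \<cdot>\<^bsub>\<C>\<^esub> f) m" "fib_homotopic \<C> p (l' \<cdot>\<^bsub>\<C>\<^esub> f) m" for l l'
  proof (rule weak_lift_unique[OF assms(4,8,3,7) l(1,2)])
    \<comment> \<open>Both composites with \<open>f\<close> are homotopic to \<open>m\<close>, hence
      to each other.\<close>
    show "fib_homotopic \<C> p (l \<cdot>\<^bsub>\<C>\<^esub> f) (l' \<cdot>\<^bsub>\<C>\<^esub> f)"
      using fib_homotopic_common_target[OF assms(4,8) _ _ assms(2) hom]
        Comp_in_Hom[OF assms(3)] l(1,2) by blast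
  qed (use l in simp)
  then show ?thesis
    using weak_lift_exists[OF assms(2-8)] by blast
qed

end
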